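(* Let \(T\) be a graph with tree-width \(2\), and let \(\vec T\) be an orientation of \(T\). Then \(\vec T\) is complete convex if and only if \(T\) is a \(2\)-tree and every induced copy of \(K_3\) in \(T\) is a directed \(3\)-cycle in \(\vec T\).
   Context: Graphs are connected with at least two vertices and no parallel edges. In an oriented graph, \(u,v,w\) is a \(2\)-dipath with centre \(v\) if \(uv,vw\) are arcs, \(u\ne v\), \(v\ne w\). A vertex set \(S\) is convex if no vertex outside \(S\) is the centre of a \(2\)-dipath with both ends in \(S\); \(conv(S)\) is the smallest convex set containing \(S\), and \(conv(uv)=conv(\{u,v\})\). An oriented graph is complete convex if \(conv(uv)\) is the whole vertex set for every arc \(uv\). *)

theory Defs
  imports "Graph_Theory.Graph_Theory"
begin

text \<open>
  An undirected graph without parallel edges is a symmetric \<^typ>\<open>'a pair_pre_digraph\<close>: an edge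
  between distinct vertices is a pair of opposite arcs, a loop is a single arc.
  An orientation keeps a loop and keeps exactly one arc of every other edge.
\<close>

definition orientation_of :: "'a pair_pre_digraph \<Rightarrow> 'a pair_pre_digraph \<Rightarrow> bool" where
  "orientation_of D G \<longleftrightarrow> mk_symmetric (with_proj D) = G \<and> antisym (parcs D)"


subsection \<open>Two-dipath convexity\<close>

definition two_dipath :: "'a pair_pre_digraph \<Rightarrow> 'a \<Rightarrow> 'a \<Rightarrow> 'a \<Rightarrow> bool" where
  "two_dipath D u v w \<longleftrightarrow> (u, v) \<in> parcs D \<and> (v, w) \<in> parcs D \<and> u \<noteq> v \<and> v \<noteq> w"

definition dipath_convex :: "'a pair_pre_digraph \<Rightarrow> 'a set \<Rightarrow> bool" where
  "dipath_convex D S \<longleftrightarrow>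
     S \<subseteq> pverts D \<and> \<not> (\<exists>v \<in> pverts D - S. \<exists>u \<in> S. \<exists>w \<in> S. two_dipath D u v w)"

definition conv :: "'a pair_pre_digraph \<Rightarrow> 'a set \<Rightarrow> 'a set" where
  "conv D S = dipath_convex D hull S"

lemma conv_least:
  assumes "S \<subseteq> pverts D"
  shows "dipath_convex D (conv D S)" and "S \<subseteq> conv D S"
    and "\<And>C. dipath_convex D C \<Longrightarrow> S \<subseteq> C \<Longrightarrow> conv D S \<subseteq> C"
proof -
  let ?F = "{C. dipath_convex D C \<and> S \<subseteq> C}"
  have top: "pverts D \<in> ?F"
    using assms by (simp add: dipath_convex_def)
  show "dipath_convex D (conv D S)"
    unfolding dipath_convex_def
  proof (intro conjI notI)
    show "conv D S \<subseteq> pverts D"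
      using top unfolding conv_def hull_def by (rule Inter_lower)
  next
    assume "\<exists>v \<in> pverts D - conv D S. \<exists>u \<in> conv D S. \<exists>w \<in> conv D S. two_dipath D u v w"
    then obtain v u w where v: "v \<in> pverts D" "v \<notin> conv D S"
      and uw: "u \<in> conv D S" "w \<in> conv D S" "two_dipath D u v w" by blast
    from v obtain C where C: "dipath_convex D C" "S \<subseteq> C" "v \<notin> C"
      by (auto simp: conv_def hull_def)
    with uw(1,2) have "u \<in> C" "w \<in> C"
      by (auto simp: conv_def hull_def)
    with C v uw(3) show False
      unfolding dipath_convex_def by blast
  qed
  show "S \<subseteq> conv D S"
    by (simp add: conv_def hull_subset)
  show "conv D S \<subseteq> C" if "dipath_convex D C" "S \<subseteq> C" for C
    using that by (simp add: conv_def hull_minimal)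
qed

definition complete_convex :: "'a pair_pre_digraph \<Rightarrow> bool" where
  "complete_convex D \<longleftrightarrow> (\<forall>(u, v) \<in> parcs D. conv D {u, v} = pverts D)"


subsection \<open>Tree-width\<close>

text \<open>
  The predicate \<^const>\<open>tree\<close> excludes directed cycles only, and in a symmetric digraph every edge
  yields a \<^const>\<open>pre_digraph.cycle\<close> of length 2. The cycles of an undirected
  simple graph are those of length at least 3 in its symmetric digraph.
\<close>

definition undirected_tree :: "'a pair_pre_digraph \<Rightarrow> bool" where
  "undirected_tree R \<longleftrightarrow> pair_graph R \<and> connected (with_proj R) \<and>
     \<not> (\<exists>p. pre_digraph.cycle (with_proj R) p \<and> 3 \<le> length p)"

definition tree_decomposition ::
  "'a pair_pre_digraph \<Rightarrow> 'b pair_pre_digraph \<Rightarrow> ('b \<Rightarrow> 'a set) \<Rightarrow> bool" where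
  "tree_decomposition G R B \<longleftrightarrow> undirected_tree R \<and>
     (\<Union>t \<in> pverts R. B t) = pverts G \<and>
     (\<forall>(u, v) \<in> parcs G. \<exists>t \<in> pverts R. u \<in> B t \<and> v \<in> B t) \<and>
     (\<forall>v \<in> pverts G. connected (with_proj R \<restriction> {t \<in> pverts R. v \<in> B t}))"

definition decomposition_width :: "'b pair_pre_digraph \<Rightarrow> ('b \<Rightarrow> 'a set) \<Rightarrow> nat" where
  "decomposition_width R B = Max ((\<lambda>t. card (B t)) ` pverts R) - 1"

text \<open>
  Decomposition trees are finite, so natural numbers suffice as their nodes. For a graph with at
  least one vertex some bag is nonempty, and the subtraction does not truncate.
\<close>

definition treewidth :: "'a pair_pre_digraph \<Rightarrow> nat" where
  "treewidth G = (LEAST k. \<exists>(R :: nat pair_pre_digraph) B.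
     tree_decomposition G R B \<and> decomposition_width R B = k)"


subsection \<open>\<open>k\<close>-trees and directed triangles\<close>

inductive k_tree :: "nat \<Rightarrow> 'a pair_pre_digraph \<Rightarrow> bool" for k where
  complete: "complete_digraph (k + 1) (with_proj G) \<Longrightarrow> k_tree k G"
| extend: "\<lbrakk>k_tree k G; C \<subseteq> pverts G; complete_digraph k (with_proj G \<restriction> C); v \<notin> pverts G\<rbrakk> \<Longrightarrow>
    k_tree k \<lparr>pverts = insert v (pverts G), parcs = parcs G \<union> {v} \<times> C \<union> C \<times> {v}\<rparr>"

definition directed_3_cycle :: "('a, 'b) pre_digraph \<Rightarrow> bool" where
  "directed_3_cycle H \<longleftrightarrow> (\<exists>a b c. distinct [a, b, c] \<and> verts H = {a, b, c} \<and>
     arcs_ends H = {(a, b), (b, c), (c, a)})"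

end

theory Submission
  imports Defs
begin

text \<open>
  Every vertex set of a graph of tree-width at most 2 contains a vertex with at most two neighbours
  inside the set: prune leaves of the decomposition tree until some vertex lies in the bag of a leaf
  only. In a complete convex orientation with at least three vertices, such a vertex \<open>v\<close> is the
  centre of a 2-dipath \<open>u v w\<close>, since otherwise removing \<open>v\<close> leaves a convex set containing an arc;
  and \<open>conv(uv)\<close> can only grow through \<open>w\<close>, which forces the arc \<open>w u\<close>. Thus \<open>v\<close> closes a directed
  triangle on the edge \<open>uw\<close>, its removal preserves complete convexity, and induction applies.
  Conversely, in a 2-tree with directed triangles a convex set containing one edge of a triangle
  contains the whole triangle, and the triangles are glued along edges.
\<close>

section \<open>Leaves of trees and connectivity by cuts\<close>

text \<open>An end \<open>u\<close> of a longest path inside \<open>X\<close> works: a second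
  neighbour of \<open>u\<close> in \<open>X\<close> would prolong the path or close a cycle. As
  \<open>X\<close> need not be connected, the leaf found may also be isolated in
  \<open>X\<close>.\<close>

lemma undirected_tree_leaf:
  assumes "undirected_tree R" "X \<subseteq> pverts R" "X \<noteq> {}"
  shows "\<exists>t\<in>X. \<exists>s. \<forall>t'\<in>X. (t, t') \<in> parcs R \<longrightarrow> t' = s"
proof (rule ccontr)
  assume "\<not> ?thesis"
  then have two: "\<exists>t'\<in>X. (t, t') \<in> parcs R \<and> t' \<noteq> s" if "t \<in> X" for t s
    using that by blast
  interpret pair_graph R
    using assms by (simp add: undirected_tree_def)
  define P where
    "P n \<longleftrightarrow> (\<exists>u p v. apath u p v \<and> set (pawalk_verts u p) \<subseteq> X \<and> length p = n)" for n
  obtain x where "x \<in> X"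
    using assms by blast
  then have "apath x [] x" "set (pawalk_verts x []) \<subseteq> X"
    using assms by (auto simp: apath_Nil_iff)
  then have "P 0"
    unfolding P_def by (metis list.size(3))
  moreover have "\<forall>n. P n \<longrightarrow> n \<le> card (pverts R)"
    unfolding P_def using length_apath by blast
  ultimately obtain n where "P n" and max: "\<And>m. P m \<Longrightarrow> m \<le> n"
    using ex_has_greatest_nat[of P 0 id] by (metis id_apply less_Suc_eq_le)
  then obtain u p v where p: "apath u p v" "set (pawalk_verts u p) \<subseteq> X" "length p = n"
    unfolding P_def by blast
  \<comment> \<open>\<open>s\<close> is the successor of \<open>u\<close> on the path. For the empty
    path the default \<open>u\<close> is harmless, since there are no loops.\<close>
  define s where "s = (if p = [] then u else snd (hd p))"
  have "u \<in> X"
    using p hd_in_awalk_verts(2) by blast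
  then obtain y where y: "y \<in> X" "(u, y) \<in> parcs R" "y \<noteq> s"
    using two by blast
  then have "y \<noteq> u"
    using no_loops' by blast
  have yu: "(y, u) \<in> parcs R"
    using y arcs_symmetric by blast
  have "y \<in> set (pawalk_verts u p)"
  proof (rule ccontr)
    assume "y \<notin> set (pawalk_verts u p)"
    then have "apath y ((y, u) # p) v"
      using yu p by (simp add: apath_Cons_iff)
    moreover have "set (pawalk_verts y ((y, u) # p)) \<subseteq> X"
      using y p by simp
    ultimately have "P (length ((y, u) # p))"
      unfolding P_def by blast
    then show False
      using max p by fastforce
  qed
  \<comment> \<open>The prefix \<open>q\<close> of the path leads from \<open>u\<close> to
    \<open>y\<close>. As \<open>y\<close> is neither \<open>u\<close> nor \<open>s\<close>, it has
    at least two arcs, so the arc \<open>(y, u)\<close> closes it to a cycle of length at least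
    3.\<close>
  then obtain q r where q: "p = q @ r" "awalk u q y"
    using awalk_decomp p(1) unfolding apath_def by blast
  have "q \<noteq> []"
    using q \<open>y \<noteq> u\<close> by (auto simp: awalk_Nil_iff)
  moreover have "q \<noteq> [e]" for e
    using q y by (auto simp: s_def awalk_simps)
  ultimately have "2 \<le> length q"
    by (cases q rule: list_exhaust_NSC) auto
  moreover have "distinct (pawalk_verts u q)"
    using p q apath_append_iff[of u q r v] by (auto simp: apath_def)
  ultimately have "cycle ((y, u) # q) \<and> 3 \<le> length ((y, u) # q)"
    using q yu unfolding cycle_def by (auto simp: awalk_Cons_iff)
  then show False
    using assms unfolding undirected_tree_def by blast
qed

text \<open>Connectivity phrased by cuts instead of walks: deleting a leaf then only requires
  choosing the side of the cut on which the leaf lies.\<close>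

definition edge_connected_on :: "'a rel \<Rightarrow> 'a set \<Rightarrow> bool" where
  "edge_connected_on E X \<longleftrightarrow>
    (\<forall>Y\<subseteq>X. Y \<noteq> {} \<longrightarrow> X - Y \<noteq> {} \<longrightarrow> (\<exists>y\<in>Y. \<exists>z\<in>X - Y. (y, z) \<in> E))"

lemma edge_connected_onE:
  assumes "edge_connected_on E X" "Y \<subseteq> X" "a \<in> Y" "b \<in> X" "b \<notin> Y"
  obtains y z where "y \<in> Y" "z \<in> X" "z \<notin> Y" "(y, z) \<in> E"
  using assms unfolding edge_connected_on_def by (metis Diff_iff empty_iff)

lemma connected_imp_edge_connected_on:
  assumes "pair_sym_digraph R" "connected (with_proj R \<restriction> X)"
  shows "edge_connected_on (parcs R) X"
  unfolding edge_connected_on_def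
proof (intro allI impI)
  fix Y assume Y: "Y \<subseteq> X" "Y \<noteq> {}" "X - Y \<noteq> {}"
  then obtain a b where ab: "a \<in> Y" "b \<in> X" "b \<notin> Y" by blast
  let ?H = "with_proj (mk_symmetric (with_proj R \<restriction> X))"
  have arcs: "arcs_ends ?H \<subseteq> parcs R \<inter> X \<times> X"
    using pair_sym_digraph.arcs_symmetric[OF assms(1)] by (auto simp: mk_symmetric_def)
  have "(a, b) \<in> rtrancl_on (verts ?H) (arcs_ends ?H)"
    using assms(2) ab Y
    unfolding connected_def strongly_connected_def reachable_def by (auto simp: mk_symmetric_def)
  \<comment> \<open>Invariant along a walk from \<open>a\<close>: either the walk is still in
    \<open>Y\<close>, or it has already crossed the cut.\<close>
  then have "b \<in> Y \<or> (\<exists>y\<in>Y. \<exists>z\<in>X - Y. (y, z) \<in> parcs R)"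
    proof (induction rule: rtrancl_on_induct)
    case base
    show ?case using ab by blast
  next
    case (step y z)
    then show ?case using arcs by blast
  qed
  then show "\<exists>y\<in>Y. \<exists>z\<in>X - Y. (y, z) \<in> parcs R"
    using ab by blast
qed

lemma edge_connected_on_remove_leaf:
  assumes "edge_connected_on E X" "sym E" "\<And>t'. t' \<in> X \<Longrightarrow> (t, t') \<in> E \<Longrightarrow> t' = s"
  shows "edge_connected_on E (X - {t})"
  unfolding edge_connected_on_def
proof (intro allI impI)
  fix Y assume "Y \<subseteq> X - {t}" "Y \<noteq> {}" "X - {t} - Y \<noteq> {}"
  then obtain a b where Y: "Y \<subseteq> X" "t \<notin> Y" and a: "a \<in> Y" and b: "b \<in> X" "b \<noteq> t" "b \<notin> Y"
    by blast
  have leaf: "t' = s" if "t' \<in> X" "(t', t) \<in> E \<or> (t, t') \<in> E" for t'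
    using assms(2,3) that by (meson symD)
  show "\<exists>y\<in>Y. \<exists>z\<in>X - {t} - Y. (y, z) \<in> E"
  \<comment> \<open>The leaf \<open>t\<close> is put on the side of its only neighbour
    \<open>s\<close>, so the edge crossing the cut of \<open>X\<close> cannot end in
    \<open>t\<close>.\<close>
  proof (cases "s \<in> Y \<and> t \<in> X")
    case True
    then have "insert t Y \<subseteq> X" "a \<in> insert t Y" "b \<notin> insert t Y" using Y a b by auto
    then obtain y z where "y \<in> insert t Y" "z \<in> X" "z \<notin> insert t Y" "(y, z) \<in> E"
      using edge_connected_onE[OF assms(1) _ _ b(1), of "insert t Y" a] by blast
    then show ?thesis using leaf True by auto
  next
    case False
    obtain y z where "y \<in> Y" "z \<in> X" "z \<notin> Y" "(y, z) \<in> E"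
      using assms(1) Y(1) a b(1,3) by (rule edge_connected_onE)
    then show ?thesis using leaf False Y by auto
  qed
qed

section \<open>Tree-width bounds degeneracy\<close>

text \<open>Leaves of the decomposition tree are pruned as long as their bags, cut down to
  \<open>W\<close>, lie in the bag of the neighbouring node. All conditions on bags are relative to
  the remaining nodes \<open>X\<close>, so that they survive the pruning.\<close>

lemma tree_decomposition_has_enclosed_vertex:
  fixes R :: "'b pair_pre_digraph" and B :: "'b \<Rightarrow> 'a set" and E :: "'a rel"
  assumes "undirected_tree R"
    and "X \<subseteq> pverts R"
    and "W \<noteq> {}"
    and "\<And>w. w \<in> W \<Longrightarrow> \<exists>t\<in>X. w \<in> B t"
    and "\<And>w. w \<in> W \<Longrightarrow> edge_connected_on (parcs R) {t \<in> X. w \<in> B t}"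
    and "\<And>u v. u \<in> W \<Longrightarrow> v \<in> W \<Longrightarrow> (u, v) \<in> E \<Longrightarrow> \<exists>t\<in>X. u \<in> B t \<and> v \<in> B t"
  shows "\<exists>v\<in>W. \<exists>t\<in>X. v \<in> B t \<and> {u \<in> W. (u, v) \<in> E} \<subseteq> B t"
proof -
  interpret R: pair_graph R
    using assms(1) by (simp add: undirected_tree_def)
  have "sym (parcs R)"
    using R.arcs_symmetric by (rule symI)
  have "finite X"
    using assms(2) R.pair_finite_verts finite_subset by blast
  then show ?thesis
    using assms(2-)
  proof (induction X rule: finite_psubset_induct)
    case (psubset X)
    have "X \<noteq> {}"
      using psubset.prems by blast
    then obtain t s where t: "t \<in> X" and leaf: "\<And>t'. t' \<in> X \<Longrightarrow> (t, t') \<in> parcs R \<Longrightarrow> t' = s"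
      using undirected_tree_leaf[OF assms(1) psubset.prems(1)] by blast
    show ?case
    \<comment> \<open>Either some vertex of \<open>W\<close> in the leaf bag is missing from the bag
      of the neighbour \<open>s\<close>, or the leaf bag adds nothing for \<open>W\<close>.\<close>
    proof (cases "\<exists>v\<in>W \<inter> B t. \<not> (s \<in> X - {t} \<and> v \<in> B s)")
      case True
      then obtain v where v: "v \<in> W" "v \<in> B t" "\<not> (s \<in> X - {t} \<and> v \<in> B s)" by blast
      \<comment> \<open>Any further node holding \<open>v\<close> would force an edge from
        \<open>t\<close> to another such node, which can only be \<open>s\<close>; that is excluded
        by the case.\<close>
      have only: "{t' \<in> X. v \<in> B t'} = {t}"
      proof (rule ccontr)
        assume "{t' \<in> X. v \<in> B t'} \<noteq> {t}"
        then obtain b where b: "b \<in> {t' \<in> X. v \<in> B t'}" "b \<notin> {t}" using t v by auto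
        have "{t} \<subseteq> {t' \<in> X. v \<in> B t'}" using t v by simp
        then obtain z where "z \<in> X" "v \<in> B z" "z \<noteq> t" "(t, z) \<in> parcs R"
          using edge_connected_onE[OF psubset.prems(4)[OF v(1)] _ _ b, of t] by auto
        then show False using leaf v by auto
      qed
      have "{u \<in> W. (u, v) \<in> E} \<subseteq> B t"
      proof
        fix u assume "u \<in> {u \<in> W. (u, v) \<in> E}"
        then obtain t' where "t' \<in> X" "u \<in> B t'" "v \<in> B t'"
          using psubset.prems(5)[of u v] v(1) by auto
        then show "u \<in> B t" using only by auto
      qed
      then show ?thesis using v t by blast
    next
      case False
      have absorbed: "s \<in> X - {t} \<and> w \<in> B s" if "w \<in> W" "w \<in> B t" for w
        using False that by auto
      have "\<exists>v\<in>W. \<exists>t'\<in>X - {t}. v \<in> B t' \<and> {u \<in> W. (u, v) \<in> E} \<subseteq> B t'"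
      proof (rule psubset.IH)
        show "X - {t} \<subset> X" "X - {t} \<subseteq> pverts R" "W \<noteq> {}"
          using t psubset.prems by blast+
        show "\<exists>t'\<in>X - {t}. w \<in> B t'" if "w \<in> W" for w
          using psubset.prems(3)[OF that] absorbed that by blast
        show "edge_connected_on (parcs R) {t' \<in> X - {t}. w \<in> B t'}" if "w \<in> W" for w
        proof -
          have "{t' \<in> X - {t}. w \<in> B t'} = {t' \<in> X. w \<in> B t'} - {t}" by blast
          then show ?thesis
            using edge_connected_on_remove_leaf[OF psubset.prems(4)[OF that] \<open>sym (parcs R)\<close>, of t s]
              leaf by simp
        qed
        show "\<exists>t'\<in>X - {t}. u \<in> B t' \<and> v \<in> B t'" if "u \<in> W" "v \<in> W" "(u, v) \<in> E" for u v
          using psubset.prems(5)[OF that] absorbed that by blast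
      qed
      then show ?thesis by blast
    qed
  qed
qed

text \<open>One node carrying all vertices. This shows that the minimum defining
  \<open>treewidth\<close> ranges over a nonempty set, and bounds it by the number of
  vertices.\<close>

lemma single_bag_decomposition:
  assumes "finite (pverts G)" "parcs G \<subseteq> pverts G \<times> pverts G"
  shows "\<exists>(R :: nat pair_pre_digraph) B.
    tree_decomposition G R B \<and> decomposition_width R B = card (pverts G) - 1"
proof -
  let ?R = "\<lparr>pverts = {0 :: nat}, parcs = {}\<rparr>"
  have "pair_graph ?R"
    by unfold_locales (auto simp: symmetric_def)
  moreover have conn: "connected (with_proj ?R \<restriction> {0})" "connected (with_proj ?R)"
    by (auto simp: connected_def strongly_connected_def mk_symmetric_def reachable_def)
  moreover have "\<not> (\<exists>p. pre_digraph.cycle (with_proj ?R) p \<and> 3 \<le> length p)"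
    by (auto simp: pre_digraph.cycle_def pre_digraph.awalk_def)
  ultimately have "undirected_tree ?R"
    unfolding undirected_tree_def by blast
  moreover have "{t. t = 0 \<and> v \<in> pverts G} = {0 :: nat}" if "v \<in> pverts G" for v
    using that by auto
  ultimately have "tree_decomposition G ?R (\<lambda>_. pverts G)"
    unfolding tree_decomposition_def using assms conn by auto
  moreover have "decomposition_width ?R (\<lambda>_. pverts G) = card (pverts G) - 1"
    by (simp add: decomposition_width_def)
  ultimately show ?thesis by blast
qed

lemma treewidth_le:
  assumes "finite (pverts G)" "parcs G \<subseteq> pverts G \<times> pverts G"
  shows "treewidth G \<le> card (pverts G) - 1"
  unfolding treewidth_def by (rule Least_le) (rule single_bag_decomposition[OF assms])

lemma treewidth_attained:
  assumes "finite (pverts G)" "parcs G \<subseteq> pverts G \<times> pverts G"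
  obtains R :: "nat pair_pre_digraph" and B
    where "tree_decomposition G R B" "decomposition_width R B = treewidth G"
proof -
  have "\<exists>(R :: nat pair_pre_digraph) B.
      tree_decomposition G R B \<and> decomposition_width R B = treewidth G"
    unfolding treewidth_def by (rule LeastI) (rule single_bag_decomposition[OF assms])
  then show thesis using that by blast
qed

text \<open>One bag contains some \<open>v\<close> in \<open>W\<close> together with all its
  neighbours in \<open>W\<close>. Its size is at most the width plus one, and \<open>v\<close>
  itself accounts for the one.\<close>

lemma treewidth_degenerate:
  assumes "finite (pverts G)" "parcs G \<subseteq> pverts G \<times> pverts G"
    and "W \<subseteq> pverts G" "W \<noteq> {}"
  shows "\<exists>v\<in>W. card {u \<in> W. u \<noteq> v \<and> (u, v) \<in> parcs G} \<le> treewidth G"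
proof -
  obtain R :: "nat pair_pre_digraph" and B
    where dec: "tree_decomposition G R B" and width: "decomposition_width R B = treewidth G"
    using treewidth_attained assms(1,2) by blast
  then have tree: "undirected_tree R" and cover: "(\<Union>t \<in> pverts R. B t) = pverts G"
    and edges: "\<And>u v. (u, v) \<in> parcs G \<Longrightarrow> \<exists>t \<in> pverts R. u \<in> B t \<and> v \<in> B t"
    and conn: "\<And>v. v \<in> pverts G \<Longrightarrow> connected (with_proj R \<restriction> {t \<in> pverts R. v \<in> B t})"
    unfolding tree_decomposition_def by blast+
  interpret R: pair_graph R
    using tree by (simp add: undirected_tree_def)
  have "\<exists>v\<in>W. \<exists>t\<in>pverts R. v \<in> B t \<and> {u \<in> W. (u, v) \<in> parcs G} \<subseteq> B t"
  proof (rule tree_decomposition_has_enclosed_vertex[OF tree subset_refl \<open>W \<noteq> {}\<close>])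
    show "\<exists>t\<in>pverts R. w \<in> B t" if "w \<in> W" for w
      using cover that assms(3) by blast
    show "edge_connected_on (parcs R) {t \<in> pverts R. w \<in> B t}" if "w \<in> W" for w
      using that assms(3) conn
      by (blast intro: connected_imp_edge_connected_on R.pair_sym_digraph_axioms)
    show "\<exists>t\<in>pverts R. u \<in> B t \<and> v \<in> B t" if "(u, v) \<in> parcs G" for u v
      using edges that by blast
  qed
  then obtain v t where v: "v \<in> W" and t: "t \<in> pverts R" "v \<in> B t"
    and sub: "{u \<in> W. (u, v) \<in> parcs G} \<subseteq> B t" by blast
  have "finite (B t)"
    using cover t assms(1) by (metis UN_upper finite_subset)
  have "card {u \<in> W. u \<noteq> v \<and> (u, v) \<in> parcs G} \<le> card (B t - {v})"
    using sub \<open>finite (B t)\<close> by (intro card_mono) auto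
  also have "\<dots> = card (B t) - 1"
    using t \<open>finite (B t)\<close> by simp
  also have "\<dots> \<le> treewidth G"
    using t R.pair_finite_verts unfolding width[symmetric] decomposition_width_def
    by (intro diff_le_mono Max_ge) auto
  finally show ?thesis using v by blast
qed

section \<open>Directed triangles as absence of transitive triangles\<close>

text \<open>Positivity of \<open>n\<close> makes \<open>card W = n\<close> imply that
  \<open>W\<close> is finite.\<close>

lemma complete_digraph_induce_iff:
  assumes "0 < n"
  shows "complete_digraph n (with_proj G \<restriction> W) \<longleftrightarrow>
    card W = n \<and> (\<forall>x\<in>W. \<forall>y\<in>W. (x, y) \<in> parcs G \<longleftrightarrow> x \<noteq> y)"
proof -
  have "with_proj G \<restriction> W = with_proj \<lparr>pverts = W, parcs = parcs G \<inter> W \<times> W\<rparr>"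
    by (auto simp: with_proj_def induce_subgraph_def)
  moreover have "parcs G \<inter> W \<times> W = {(u, v). (u, v) \<in> W \<times> W \<and> u \<noteq> v} \<longleftrightarrow>
      (\<forall>x\<in>W. \<forall>y\<in>W. (x, y) \<in> parcs G \<longleftrightarrow> x \<noteq> y)"
    by (auto simp: set_eq_iff)
  ultimately show ?thesis
    using assms card_ge_0_finite[of W] by (auto simp: complete_digraph_pair_def)
qed

lemma mk_symmetric_with_proj:
  "mk_symmetric (with_proj D) = \<lparr>pverts = pverts D, parcs = parcs D \<union> (parcs D)\<inverse>\<rparr>"
  by (auto simp: mk_symmetric_def)

definition transitive_triangle_free :: "'a rel \<Rightarrow> bool" where
  "transitive_triangle_free A \<longleftrightarrow> \<not> (\<exists>a b c. (a, b) \<in> A \<and> (b, c) \<in> A \<and> (a, c) \<in> A)"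

lemma transitive_triangle_freeD:
  "\<lbrakk>transitive_triangle_free A; (a, b) \<in> A; (b, c) \<in> A; (a, c) \<in> A\<rbrakk> \<Longrightarrow> False"
  unfolding transitive_triangle_free_def by blast

text \<open>A tournament on three vertices is either a directed cycle or transitive.\<close>

lemma triangles_directed_iff:
  assumes "irrefl (parcs D)" "antisym (parcs D)" "parcs D \<subseteq> pverts D \<times> pverts D"
  shows "(\<forall>W \<subseteq> pverts D. complete_digraph 3 (with_proj (mk_symmetric (with_proj D)) \<restriction> W) \<longrightarrow>
      directed_3_cycle (with_proj D \<restriction> W)) \<longleftrightarrow> transitive_triangle_free (parcs D)"
    (is "?L \<longleftrightarrow> ?R")
proof -
  have ends: "arcs_ends (with_proj D \<restriction> W) = parcs D \<inter> W \<times> W" for W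
    by (auto simp: arcs_ends_def arc_to_ends_def image_iff)
  have asym: "(y, x) \<notin> parcs D" if "(x, y) \<in> parcs D" for x y
    using assms that by (metis antisymD irreflD)
  show ?thesis
  proof
    assume L: ?L
    show ?R
      unfolding transitive_triangle_free_def
    proof
      assume "\<exists>a b c. (a, b) \<in> parcs D \<and> (b, c) \<in> parcs D \<and> (a, c) \<in> parcs D"
      then obtain a b c where
        abc: "(a, b) \<in> parcs D" "(b, c) \<in> parcs D" "(a, c) \<in> parcs D" by blast
      then have ne: "a \<noteq> b" "b \<noteq> c" "a \<noteq> c" and W: "{a, b, c} \<subseteq> pverts D"
        using assms(1,3) by (auto dest: irreflD)
      have "complete_digraph 3 (with_proj (mk_symmetric (with_proj D)) \<restriction> {a, b, c})"
        using abc ne assms(1)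
        by (simp add: complete_digraph_induce_iff mk_symmetric_with_proj irrefl_def)
      then have "directed_3_cycle (with_proj D \<restriction> {a, b, c})"
        using L W by blast
      then obtain x y z where "distinct [x, y, z]"
          "parcs D \<inter> {a, b, c} \<times> {a, b, c} = {(x, y), (y, z), (z, x)}"
        unfolding directed_3_cycle_def ends by blast
      moreover have "(a, b) \<in> parcs D \<inter> {a, b, c} \<times> {a, b, c}" "(a, c) \<in> parcs D \<inter> {a, b, c} \<times> {a, b, c}"
        using abc by auto
      ultimately show False
        using ne by auto
    qed
  next
    assume R: ?R
    show ?L
    proof (intro allI impI)
      fix W assume W: "W \<subseteq> pverts D"
        "complete_digraph 3 (with_proj (mk_symmetric (with_proj D)) \<restriction> W)"
      then have "card W = 3" and adj: "\<And>x y. \<lbrakk>x \<in> W; y \<in> W; x \<noteq> y\<rbrakk> \<Longrightarrow> (x, y) \<in> parcs D \<or> (y, x) \<in> parcs D"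
        by (auto simp: complete_digraph_induce_iff mk_symmetric_with_proj)
      then obtain a b c where abc: "W = {a, b, c}" "distinct [a, b, c]"
        by (auto simp: card_3_iff)
      \<comment> \<open>Stated for every labelling in which \<open>(a, b)\<close> is an arc; the
        opposite orientation is then handled by swapping \<open>a\<close> and
        \<open>b\<close>.\<close>
      have cyc: "directed_3_cycle (with_proj D \<restriction> W)"
        if W': "W = {a, b, c}" "distinct [a, b, c]" and ab: "(a, b) \<in> parcs D" for a b c
      proof -
        have "(b, c) \<in> parcs D \<or> (c, b) \<in> parcs D" "(a, c) \<in> parcs D \<or> (c, a) \<in> parcs D"
          using W' adj[of b c] adj[of a c] by auto
        then have arcs: "(b, c) \<in> parcs D" "(c, a) \<in> parcs D"
          using ab transitive_triangle_freeD[OF R] by blast+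
        have "parcs D \<inter> W \<times> W = {(a, b), (b, c), (c, a)}"
          using W' ab arcs asym irreflD[OF assms(1)] by auto
        then show ?thesis
          unfolding directed_3_cycle_def ends using W' by auto
      qed
      show "directed_3_cycle (with_proj D \<restriction> W)"
      proof (cases "(a, b) \<in> parcs D")
        case True
        then show ?thesis using cyc abc by blast
      next
        case False
        then have "(b, a) \<in> parcs D" using abc adj[of a b] by auto
        moreover have "W = {b, a, c}" "distinct [b, a, c]" using abc by auto
        ultimately show ?thesis using cyc by blast
      qed
    qed
  qed
qed

lemma k_tree_arcs:
  assumes "k_tree k G"
  shows "parcs G \<subseteq> pverts G \<times> pverts G \<and> irrefl (parcs G)"
  using assms
  by induction (auto simp: complete_digraph_pair_def irrefl_def)

section \<open>From 2-trees with directed triangles to complete convexity\<close>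

text \<open>Replaces hulls by a test on convex sets, the form in which all later arguments are
  made.\<close>

lemma complete_convex_iff:
  assumes "parcs D \<subseteq> pverts D \<times> pverts D"
  shows "complete_convex D \<longleftrightarrow>
    (\<forall>x y S. (x, y) \<in> parcs D \<longrightarrow> dipath_convex D S \<longrightarrow> x \<in> S \<longrightarrow> y \<in> S \<longrightarrow> S = pverts D)"
    (is "?L \<longleftrightarrow> ?R")
proof
  assume L: ?L
  show ?R
  proof (intro allI impI)
    fix x y S assume *: "(x, y) \<in> parcs D" "dipath_convex D S" "x \<in> S" "y \<in> S"
    then have "{x, y} \<subseteq> pverts D" "S \<subseteq> pverts D"
      using assms by (auto simp: dipath_convex_def)
    moreover have "conv D {x, y} = pverts D"
      using L * by (auto simp: complete_convex_def)
    moreover have "conv D {x, y} \<subseteq> S"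
      using conv_least(3)[OF \<open>{x, y} \<subseteq> pverts D\<close> *(2)] * by simp
    ultimately show "S = pverts D" by simp
  qed
next
  assume R: ?R
  show ?L
    unfolding complete_convex_def
  proof (clarify)
    fix x y assume xy: "(x, y) \<in> parcs D"
    then have "{x, y} \<subseteq> pverts D" using assms by auto
    from conv_least(1,2)[OF this] show "conv D {x, y} = pverts D"
      using R xy by (meson insert_subset)
  qed
qed

lemma dipath_convexD:
  assumes "dipath_convex D S" "(u, v) \<in> parcs D" "(v, w) \<in> parcs D" "u \<in> S" "w \<in> S" "v \<in> pverts D"
  shows "v \<in> S"
  using assms unfolding dipath_convex_def two_dipath_def by blast

text \<open>Without transitive triangles the three edges form a directed cycle, in which each vertex
  is the centre of a 2-dipath between the other two.\<close>

lemma dipath_convex_triangle: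
  assumes "dipath_convex D S" "transitive_triangle_free (parcs D)"
    and "(x, y) \<in> parcs D \<union> (parcs D)\<inverse>" "(x, z) \<in> parcs D \<union> (parcs D)\<inverse>"
      "(y, z) \<in> parcs D \<union> (parcs D)\<inverse>"
    and "x \<in> S" "y \<in> S" "z \<in> pverts D"
  shows "z \<in> S"
proof -
  have "(x, y) \<in> parcs D \<or> (y, x) \<in> parcs D" "(x, z) \<in> parcs D \<or> (z, x) \<in> parcs D"
    "(y, z) \<in> parcs D \<or> (z, y) \<in> parcs D"
    using assms(3-5) by auto
  moreover have no: "(a, c) \<notin> parcs D" if "(a, b) \<in> parcs D" "(b, c) \<in> parcs D" for a b c
    using that transitive_triangle_freeD[OF assms(2)] by blast
  ultimately have "(x, z) \<in> parcs D \<and> (z, y) \<in> parcs D \<or> (y, z) \<in> parcs D \<and> (z, x) \<in> parcs D"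
    by metis
  then show ?thesis
    using dipath_convexD[OF assms(1), of x z y] dipath_convexD[OF assms(1), of y z x] assms(6-8)
    by blast
qed

text \<open>Induction over the construction of the 2-tree with \<open>D\<close> fixed.
  \<open>G\<close> is only required to be a subgraph of the underlying graph of \<open>D\<close>, so
  that the smaller 2-trees qualify as well.\<close>

lemma k_tree_subset_dipath_convex:
  assumes "k_tree 2 G"
    and "dipath_convex D S" "transitive_triangle_free (parcs D)"
    and "pverts G \<subseteq> pverts D" "parcs G \<subseteq> parcs D \<union> (parcs D)\<inverse>"
    and "(x, y) \<in> parcs G" "x \<in> S" "y \<in> S"
  shows "pverts G \<subseteq> S"
  using assms(1,4-)
proof (induction arbitrary: x y)
  case (complete G)
  show ?case
  proof
    fix z assume "z \<in> pverts G"
    show "z \<in> S"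
    proof (cases "z = x \<or> z = y")
      case False
      have "(x, z) \<in> parcs G" "(y, z) \<in> parcs G"
        using complete.hyps complete.prems(3) False \<open>z \<in> pverts G\<close>
        by (auto simp: complete_digraph_pair_def)
      then show ?thesis
        using dipath_convex_triangle[OF assms(2,3), of x y z] complete.prems \<open>z \<in> pverts G\<close> by blast
    qed (use complete.prems in auto)
  qed
next
  case (extend G C v)
  have C: "card C = 2" "\<And>p q. p \<in> C \<Longrightarrow> q \<in> C \<Longrightarrow> p \<noteq> q \<Longrightarrow> (p, q) \<in> parcs G"
    using extend.hyps(3) by (auto simp: complete_digraph_induce_iff)
  have sub: "pverts G \<subseteq> pverts D" "parcs G \<subseteq> parcs D \<union> (parcs D)\<inverse>" "v \<in> pverts D"
    using extend.prems(1,2) by auto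
  have new: "(p, v) \<in> parcs D \<union> (parcs D)\<inverse>" "(v, p) \<in> parcs D \<union> (parcs D)\<inverse>" if "p \<in> C" for p
    using extend.prems(2) that by auto
  \<comment> \<open>The edge inside \<open>S\<close> is either old or joins the new vertex
    \<open>v\<close> to some \<open>p\<close> in \<open>C\<close>. An old edge yields all of
    \<open>G\<close> and then \<open>v\<close>; a new edge first yields the other vertex
    \<open>q\<close> of \<open>C\<close>, hence the old edge \<open>pq\<close>.\<close>
  consider "(x, y) \<in> parcs G" | p where "p \<in> C" "p \<in> S" "v \<in> S"
    using extend.prems by auto
  then show ?case
  proof cases
    case 1
    then have GS: "pverts G \<subseteq> S"
      using extend.IH sub(1,2) extend.prems(4,5) by blast
    obtain p q where pq: "p \<in> C" "q \<in> C" "p \<noteq> q"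
      using C(1) by (auto simp: card_2_iff)
    then have "p \<in> S" "q \<in> S" using GS extend.hyps(2) by auto
    then have "v \<in> S"
      using dipath_convex_triangle[OF assms(2,3) subsetD[OF sub(2) C(2)[OF pq]] new(1)[OF pq(1)]
          new(1)[OF pq(2)]] sub(3) by simp
    then show ?thesis using GS by simp
  next
    case 2
    obtain q where q: "q \<in> C" "q \<noteq> p"
      using C(1) 2(1) by (auto simp: card_2_iff)
    then have pq: "(p, q) \<in> parcs G"
      using C(2) 2(1) by blast
    have "q \<in> S"
      using dipath_convex_triangle[OF assms(2,3) new(1)[OF 2(1)] subsetD[OF sub(2) pq]
          new(2)[OF q(1)] 2(2,3)] q(1) extend.hyps(2) sub(1) by blast
    then have "pverts G \<subseteq> S"
      using extend.IH[of p q] sub(1,2) 2 pq by blast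
    then show ?thesis using 2 by simp
  qed
qed

lemma k_tree_complete_convex:
  assumes "k_tree 2 (mk_symmetric (with_proj D))" "transitive_triangle_free (parcs D)"
  shows "complete_convex D"
proof -
  have "parcs D \<subseteq> pverts D \<times> pverts D"
    using k_tree_arcs[OF assms(1)] by (auto simp: mk_symmetric_with_proj)
  moreover have "S = pverts D"
    if "(x, y) \<in> parcs D" "dipath_convex D S" "x \<in> S" "y \<in> S" for x y S
    using k_tree_subset_dipath_convex[OF assms(1) that(2) assms(2), of x y] that
    by (auto simp: mk_symmetric_with_proj dipath_convex_def)
  ultimately show ?thesis
    by (auto simp: complete_convex_iff)
qed

section \<open>From complete convexity to 2-trees\<close>

text \<open>A 2-dipath from \<open>v\<close> back to \<open>v\<close> would use opposite arcs, so
  \<open>{v}\<close> is convex; a loop at \<open>v\<close> would make it the whole vertex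
  set.\<close>

lemma complete_convex_irrefl:
  assumes "complete_convex D" "parcs D \<subseteq> pverts D \<times> pverts D" "antisym (parcs D)"
    and "2 \<le> card (pverts D)"
  shows "irrefl (parcs D)"
proof (rule irreflI)
  fix v show "(v, v) \<notin> parcs D"
  proof
    assume v: "(v, v) \<in> parcs D"
    then have "dipath_convex D {v}"
      using assms(2,3) by (auto simp: dipath_convex_def two_dipath_def dest: antisymD)
    then have "{v} = pverts D"
      using assms(1,2) v by (auto simp: complete_convex_iff)
    then have "card (pverts D) = 1"
      by (metis is_singletonI is_singleton_altdef)
    then show False
      using assms(4) by simp
  qed
qed

abbreviation induced :: "'a pair_pre_digraph \<Rightarrow> 'a set \<Rightarrow> 'a pair_pre_digraph" where
  "induced D W \<equiv> \<lparr>pverts = W, parcs = parcs D \<inter> W \<times> W\<rparr>"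

lemma complete_convex_degree_2:
  assumes "complete_convex D" "parcs D \<subseteq> pverts D \<times> pverts D" "antisym (parcs D)"
    and "parcs D \<noteq> {}" "finite (pverts D)" "3 \<le> card (pverts D)"
    and "v \<in> pverts D" "card {u \<in> pverts D. u \<noteq> v \<and> (u, v) \<in> parcs D \<union> (parcs D)\<inverse>} \<le> 2"
      (is "card ?N \<le> 2")
  obtains u w where "?N = {u, w}" "(u, v) \<in> parcs D" "(v, w) \<in> parcs D" "(w, u) \<in> parcs D"
proof -
  note full = assms(1)[unfolded complete_convex_iff[OF assms(2)], rule_format]
  have irrefl: "(x, x) \<notin> parcs D" for x
    using complete_convex_irrefl[OF assms(1-3)] assms(6) by (auto dest: irreflD)
  then have asym: "(y, x) \<notin> parcs D" if "(x, y) \<in> parcs D" for x y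
    using assms(3) that by (metis antisymD)
  \<comment> \<open>With at least three vertices, the ends of an arc cannot form a convex set, so
    every arc lies in a triangle. Transitive triangles are not yet excluded here.\<close>
  have pair: "\<exists>z. z \<noteq> x \<and> z \<noteq> y \<and> (y, z) \<in> parcs D \<and> (z, x) \<in> parcs D \<or>
      z \<noteq> x \<and> z \<noteq> y \<and> (x, z) \<in> parcs D \<and> (z, y) \<in> parcs D" if "(x, y) \<in> parcs D" for x y
  proof (rule ccontr)
    assume no: "\<not> ?thesis"
    have "dipath_convex D {x, y}"
      using assms(2) that no asym unfolding dipath_convex_def two_dipath_def by blast
    then have "{x, y} = pverts D"
      using full that by blast
    then have "card (pverts D) = card {x, y}" by simp
    also have "\<dots> \<le> 2" by (cases "x = y") auto
    finally show False using assms(6) by simp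
  qed
  \<comment> \<open>Of the three edges of a triangle, at least one avoids \<open>v\<close>.\<close>
  obtain x y where xy: "(x, y) \<in> parcs D" "x \<noteq> v" "y \<noteq> v"
  proof -
    obtain x y where xy: "(x, y) \<in> parcs D" using assms(4) by auto
    from pair[OF this] xy irrefl show thesis using that by metis
  qed
  have "\<not> dipath_convex D (pverts D - {v})"
  proof
    assume "dipath_convex D (pverts D - {v})"
    then have "pverts D - {v} = pverts D"
      using full[OF xy(1)] xy assms(2) by blast
    then show False using assms(7) by blast
  qed
  then obtain u w where uvw: "(u, v) \<in> parcs D" "(v, w) \<in> parcs D"
    unfolding dipath_convex_def two_dipath_def by blast
  then have "u \<noteq> w" using asym by blast
  have "{u, w} \<subseteq> ?N"
    using uvw assms(2) irrefl by auto
  moreover have "card {u, w} = 2"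
    using \<open>u \<noteq> w\<close> by simp
  ultimately have N: "?N = {u, w}"
    using card_seteq[of ?N "{u, w}"] assms(5,8) by simp
  \<comment> \<open>A triangle on the arc \<open>(u, v)\<close> must have \<open>w\<close> as third
    vertex. As \<open>(v, w)\<close> is an arc, only the cyclic orientation remains.\<close>
  obtain z where z: "z \<noteq> u" "z \<noteq> v"
      "(v, z) \<in> parcs D \<and> (z, u) \<in> parcs D \<or> (u, z) \<in> parcs D \<and> (z, v) \<in> parcs D"
    using pair[OF uvw(1)] by blast
  then have "z \<in> ?N"
    using assms(2) by auto
  then have "z = w" using N z by blast
  then have "(w, u) \<in> parcs D"
    using z asym uvw by blast
  then show thesis using that N uvw by blast
qed

text \<open>A convex set \<open>S\<close> of the smaller graph becomes convex in \<open>D\<close>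
  after adding \<open>v\<close> if it contains both \<open>u\<close> and \<open>w\<close>, and is
  already convex in \<open>D\<close> otherwise.\<close>

lemma complete_convex_remove:
  assumes "complete_convex D" "parcs D \<subseteq> pverts D \<times> pverts D"
    and "v \<in> pverts D" "(u, v) \<in> parcs D" "(v, w) \<in> parcs D"
    and "{z \<in> pverts D. z \<noteq> v \<and> (z, v) \<in> parcs D \<union> (parcs D)\<inverse>} = {u, w}" "antisym (parcs D)"
  shows "complete_convex (induced D (pverts D - {v}))" (is "complete_convex ?D")
proof -
  note full = assms(1)[unfolded complete_convex_iff[OF assms(2)], rule_format]
  have N: "z = u \<or> z = w" if "z \<noteq> v" "(z, v) \<in> parcs D \<or> (v, z) \<in> parcs D" for z
    using that assms(2,6) by blast
  have "S = pverts ?D" if "(x, y) \<in> parcs ?D" "dipath_convex ?D S" "x \<in> S" "y \<in> S" for x y S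
  proof -
    have S: "S \<subseteq> pverts D" "v \<notin> S"
      using that(2) by (auto simp: dipath_convex_def)
    have S': "z \<in> S" if "a \<in> S" "b \<in> S" "(a, z) \<in> parcs D" "(z, b) \<in> parcs D" "z \<noteq> v" for a b z
      using dipath_convexD[OF \<open>dipath_convex ?D S\<close>, of a z b] that S assms(2) by auto
    show ?thesis
    proof (cases "u \<in> S \<and> w \<in> S")
      case True
      have "dipath_convex D (insert v S)"
        unfolding dipath_convex_def two_dipath_def
      proof (intro conjI notI)
        show "insert v S \<subseteq> pverts D" using S assms(3) by simp
        assume "\<exists>z\<in>pverts D - insert v S. \<exists>a\<in>insert v S. \<exists>b\<in>insert v S.
          (a, z) \<in> parcs D \<and> (z, b) \<in> parcs D \<and> a \<noteq> z \<and> z \<noteq> b"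
        then obtain z a b where "z \<noteq> v" "z \<notin> S" "a \<in> insert v S" "b \<in> insert v S"
            "(a, z) \<in> parcs D" "(z, b) \<in> parcs D" by blast
        \<comment> \<open>A 2-dipath with \<open>v\<close> as an end has its centre in
          \<open>{u, w}\<close>, which lies in \<open>S\<close>; one without \<open>v\<close>
          belongs to the smaller graph.\<close>
        then show False using N[of z] S' True by blast
      qed
      then have "insert v S = pverts D"
        using full[of x y] that by simp
      then show ?thesis using S by auto
    next
      case False
      have "dipath_convex D S"
        unfolding dipath_convex_def two_dipath_def
      proof (intro conjI notI)
        show "S \<subseteq> pverts D" using S by simp
        assume "\<exists>z\<in>pverts D - S. \<exists>a\<in>S. \<exists>b\<in>S.
          (a, z) \<in> parcs D \<and> (z, b) \<in> parcs D \<and> a \<noteq> z \<and> z \<noteq> b"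
        then obtain z a b where z: "z \<notin> S" "a \<in> S" "b \<in> S"
            "(a, z) \<in> parcs D" "(z, b) \<in> parcs D" by blast
        then have "z = v" using S' by blast
        have "a \<noteq> v" "b \<noteq> v" using z S by auto
        then have "a = u \<or> a = w" "b = u \<or> b = w" using z \<open>z = v\<close> N by auto
        \<comment> \<open>Only one of \<open>u\<close>, \<open>w\<close> can lie in
          \<open>S\<close>, so a 2-dipath centred at \<open>v\<close> would start and end there,
          against antisymmetry.\<close>
        then have "a = b" using z False by blast
        then have "a = v" using z \<open>z = v\<close> assms(7) by (meson antisymD)
        then show False using z S by blast
      qed
      \<comment> \<open>This contradicts that \<open>v\<close> is not in \<open>S\<close>, so the
        case cannot occur.\<close>
      then have "S = pverts D"
        using full[of x y] that by simp
      then show ?thesis using S assms(3) by simp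
    qed
  qed
  then show ?thesis
    by (subst complete_convex_iff) auto
qed

text \<open>Induction on the number of vertices. Tree-width enters only through degeneracy on all
  vertex subsets, which passes directly to \<open>D\<close> without \<open>v\<close>.\<close>

lemma complete_convex_degenerate_k_tree:
  assumes "complete_convex D" "parcs D \<subseteq> pverts D \<times> pverts D" "antisym (parcs D)"
    and "parcs D \<noteq> {}" "finite (pverts D)" "3 \<le> card (pverts D)"
    and "\<And>W. W \<subseteq> pverts D \<Longrightarrow> W \<noteq> {} \<Longrightarrow>
      \<exists>v\<in>W. card {u \<in> W. u \<noteq> v \<and> (u, v) \<in> parcs D \<union> (parcs D)\<inverse>} \<le> 2"
  shows "k_tree 2 (mk_symmetric (with_proj D)) \<and> transitive_triangle_free (parcs D)"
  using assms
proof (induction "card (pverts D)" arbitrary: D rule: less_induct)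
  case less
  have "pverts D \<noteq> {}" using less.prems(6) by auto
  then obtain v where v: "v \<in> pverts D"
    and deg: "card {u \<in> pverts D. u \<noteq> v \<and> (u, v) \<in> parcs D \<union> (parcs D)\<inverse>} \<le> 2"
    using less.prems(7)[OF subset_refl] by blast
  obtain u w where
    N: "{z \<in> pverts D. z \<noteq> v \<and> (z, v) \<in> parcs D \<union> (parcs D)\<inverse>} = {u, w}"
    and arcs: "(u, v) \<in> parcs D" "(v, w) \<in> parcs D" "(w, u) \<in> parcs D"
    using complete_convex_degree_2[OF less.prems(1-6) v deg] by blast
  have irrefl: "(x, x) \<notin> parcs D" for x
    using complete_convex_irrefl[OF less.prems(1-3)] less.prems(6) by (auto dest: irreflD)
  then have asym: "(y, x) \<notin> parcs D" if "(x, y) \<in> parcs D" for x y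
    using less.prems(3) that by (metis antisymD)
  have ne: "u \<noteq> v" "v \<noteq> w" "w \<noteq> u"
    using arcs irrefl by blast+
  have N': "z = u \<or> z = w" if "(z, v) \<in> parcs D \<or> (v, z) \<in> parcs D" for z
    using that N less.prems(2) irrefl by blast
  define D' where "D' = induced D (pverts D - {v})"
  have wu: "(w, u) \<in> parcs D'"
    using arcs ne less.prems(2) by (auto simp: D'_def)
  have card: "card (pverts D) = Suc (card (pverts D'))"
    using v less.prems(5) unfolding D'_def by (metis card_Suc_Diff1 pair_pre_digraph.select_convs(1))
  have cc: "complete_convex D'"
    unfolding D'_def
    using complete_convex_remove[OF less.prems(1,2) v arcs(1,2) N less.prems(3)] .
  have D': "parcs D' \<subseteq> pverts D' \<times> pverts D'" "antisym (parcs D')" "finite (pverts D')"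
    using less.prems(3,5) by (auto simp: D'_def antisym_def)
  have arcs_D: "parcs D = parcs D' \<union> {(u, v), (v, w)}"
    using less.prems(2) arcs asym N' by (auto simp: D'_def)
  have verts_D: "pverts D = insert v (pverts D')"
    using v by (auto simp: D'_def)
  \<comment> \<open>A transitive triangle through \<open>v\<close> would lie on \<open>u\<close>,
    \<open>v\<close>, \<open>w\<close>, whose arcs form a directed cycle.\<close>
  have free: "transitive_triangle_free (parcs D)" if free': "transitive_triangle_free (parcs D')"
    unfolding transitive_triangle_free_def
  proof
    assume "\<exists>a b c. (a, b) \<in> parcs D \<and> (b, c) \<in> parcs D \<and> (a, c) \<in> parcs D"
    then obtain a b c where
      abc: "(a, b) \<in> parcs D" "(b, c) \<in> parcs D" "(a, c) \<in> parcs D" by blast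
    have "v \<in> {a, b, c}"
      using transitive_triangle_freeD[OF free', of a b c] abc arcs_D by auto
    then show False
      using abc N' arcs asym irrefl by blast
  qed
  show ?case
  \<comment> \<open>With three vertices left in \<open>D'\<close> the induction applies and
    \<open>v\<close> is attached to the edge \<open>uw\<close>; otherwise \<open>D\<close> itself is
    a directed triangle, the initial \<open>K_3\<close> of a 2-tree.\<close>
  proof (cases "3 \<le> card (pverts D')")
    case True
    have "k_tree 2 (mk_symmetric (with_proj D')) \<and> transitive_triangle_free (parcs D')"
    proof (rule less.hyps)
      show "\<exists>z\<in>W. card {x \<in> W. x \<noteq> z \<and> (x, z) \<in> parcs D' \<union> (parcs D')\<inverse>} \<le> 2"
        if W: "W \<subseteq> pverts D'" "W \<noteq> {}" for W
      proof -
        have "{x \<in> W. x \<noteq> z \<and> (x, z) \<in> parcs D' \<union> (parcs D')\<inverse>} =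
            {x \<in> W. x \<noteq> z \<and> (x, z) \<in> parcs D \<union> (parcs D)\<inverse>}" if "z \<in> W" for z
          using W(1) that by (auto simp: D'_def)
        then show ?thesis
          using less.prems(7)[of W] W by (auto simp: D'_def)
      qed
    qed (use card cc D' wu True in auto)
    then have IH: "k_tree 2 (mk_symmetric (with_proj D'))" "transitive_triangle_free (parcs D')"
      by auto
    have "mk_symmetric (with_proj D) = \<lparr>pverts = insert v (pverts (mk_symmetric (with_proj D'))),
        parcs = parcs (mk_symmetric (with_proj D')) \<union> {v} \<times> {u, w} \<union> {u, w} \<times> {v}\<rparr>"
      using arcs_D verts_D by (auto simp: mk_symmetric_with_proj)
    moreover have "k_tree 2 \<dots>"
    proof (rule k_tree.extend[OF IH(1)])
      show "{u, w} \<subseteq> pverts (mk_symmetric (with_proj D'))"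
        using wu D'(1) by (auto simp: mk_symmetric_with_proj)
      show "complete_digraph 2 (with_proj (mk_symmetric (with_proj D')) \<restriction> {u, w})"
        using wu ne irrefl by (auto simp: complete_digraph_induce_iff mk_symmetric_with_proj D'_def)
      show "v \<notin> pverts (mk_symmetric (with_proj D'))"
        by (simp add: mk_symmetric_with_proj D'_def)
    qed
    ultimately show ?thesis using free IH(2) by simp
  next
    case False
    then have "card (pverts D') = 2" using card less.prems(6) by simp
    moreover have "{w, u} \<subseteq> pverts D'" using wu D'(1) by auto
    ultimately have V': "pverts D' = {w, u}"
      using card_seteq[OF D'(3), of "{w, u}"] ne by simp
    have "(w, w) \<notin> parcs D'" "(u, u) \<notin> parcs D'" "(u, w) \<notin> parcs D'"
      using irrefl asym[OF arcs(3)] by (auto simp: D'_def)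
    then have arcs': "parcs D' = {(w, u)}"
      using D'(1)[unfolded V'] wu by blast
    have "transitive_triangle_free {(w, u)}"
      using ne(3) by (auto simp: transitive_triangle_free_def)
    then have "transitive_triangle_free (parcs D)"
      using free arcs' by simp
    moreover
    have "parcs (mk_symmetric (with_proj D)) =
        {(w, u), (u, v), (v, w), (u, w), (v, u), (w, v)}"
      using arcs_D arcs' by (auto simp: mk_symmetric_with_proj)
    then have "k_tree 2 (mk_symmetric (with_proj D))"
      using verts_D V' ne
      by (intro k_tree.complete) (auto simp: complete_digraph_pair_def mk_symmetric_with_proj)
    ultimately show ?thesis by simp
  qed
qed

section \<open>The equivalence for tree-width 2\<close>

theorem theorem8:
  fixes T D :: "'a pair_pre_digraph"
  assumes "pair_pseudo_graph T"
    and "connected (with_proj T)"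
    and "2 \<le> card (pverts T)"
    and "treewidth T = 2"
    and "orientation_of D T"
  shows "complete_convex D \<longleftrightarrow>
    k_tree 2 T \<and>
    (\<forall>W \<subseteq> pverts T. complete_digraph 3 (with_proj T \<restriction> W) \<longrightarrow>
       directed_3_cycle (with_proj D \<restriction> W))"
    (is "_ \<longleftrightarrow> _ \<and> ?directed")
proof -
  interpret T: pair_pseudo_graph T by fact
  have T: "T = mk_symmetric (with_proj D)" and antisym: "antisym (parcs D)"
    using assms(5) by (auto simp: orientation_of_def)
  then have verts: "pverts T = pverts D" and arcs: "parcs T = parcs D \<union> (parcs D)\<inverse>"
    by (auto simp: mk_symmetric_with_proj)
  have wf: "parcs T \<subseteq> pverts T \<times> pverts T"
    using T.in_arcsD1 T.in_arcsD2 by auto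
  then have wf_D: "parcs D \<subseteq> pverts D \<times> pverts D"
    using arcs verts by auto
  \<comment> \<open>Induced triangles do not see loops elsewhere, so irreflexivity is a premise;
    complete convexity and the 2-tree property each supply it.\<close>
  have directed: "?directed \<longleftrightarrow> transitive_triangle_free (parcs D)" if "irrefl (parcs D)"
    using triangles_directed_iff[OF that antisym wf_D] T verts by simp
  show ?thesis
  proof
    assume cc: "complete_convex D"
    have "2 \<le> card (pverts T) - 1"
      using treewidth_le[OF T.pair_finite_verts wf] assms(4) by simp
    then have "3 \<le> card (pverts D)"
      using verts by simp
    \<comment> \<open>Rules out that complete convexity holds vacuously: a connected graph with two
      vertices has an edge leaving \<open>a\<close>.\<close>
    moreover have "parcs D \<noteq> {}"
    proof -
      have "with_proj T \<restriction> pverts T = with_proj T"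
        using wf by (auto simp: with_proj_def induce_subgraph_def)
      then have conn: "edge_connected_on (parcs T) (pverts T)"
        using connected_imp_edge_connected_on[OF T.pair_sym_digraph_axioms, of "pverts T"] assms(2)
        by simp
      have "pverts T \<noteq> {}"
        using assms(3) by auto
      then obtain a where a: "a \<in> pverts T" by blast
      have "pverts T \<noteq> {a}"
        using assms(3) by auto
      then obtain b where "b \<in> pverts T" "b \<noteq> a"
        using a by blast
      then obtain z where "(a, z) \<in> parcs T"
        using edge_connected_onE[OF conn, of "{a}" a b] a by auto
      then show ?thesis using arcs by auto
    qed
    moreover have "\<exists>v\<in>W. card {u \<in> W. u \<noteq> v \<and> (u, v) \<in> parcs D \<union> (parcs D)\<inverse>} \<le> 2"
      if "W \<subseteq> pverts D" "W \<noteq> {}" for W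
      using treewidth_degenerate[OF T.pair_finite_verts wf, of W] that
      unfolding verts arcs assms(4) by simp
    ultimately have "k_tree 2 T \<and> transitive_triangle_free (parcs D)"
      using complete_convex_degenerate_k_tree[OF cc wf_D antisym] T.pair_finite_verts T verts by simp
    moreover have "irrefl (parcs D)"
      using complete_convex_irrefl[OF cc wf_D antisym] assms(3) verts by simp
    ultimately show "k_tree 2 T \<and> ?directed"
      using directed by blast
  next
    assume R: "k_tree 2 T \<and> ?directed"
    then have "irrefl (parcs D)"
      using k_tree_arcs[of 2 T] arcs by (auto simp: irrefl_def)
    then show "complete_convex D"
      using k_tree_complete_convex[of D] R directed T by simp
  qed
qed

end
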